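(* For every monotonically shrinking temporal split graph $\mathcal{S}$ (that is, every monotonically shrinking temporal graph whose underlying static graph is a split graph), there exists a Nash equilibrium in the two-player temporal Voronoi game $\mathrm{Vor}(\mathcal{S},2)$.
   Context: A temporal graph $\mathcal{G}=(V,(E_t)_{t=1}^\infty)$ consists of a finite nonempty vertex set $V$ and an infinite sequence of edge sets $E_t\subseteq\binom{V}{2}$; it is assumed that the sequence is eventually constant (finite lifetime), i.e. there is $\tau$ with $E_t=E_\tau$ for all $t\ge\tau$. The underlying static graph is $(V,\bigcup_{t\ge1}E_t)$. A split graph is a static graph whose vertex set can be partitioned into a clique and an independent set; a temporal split graph is a temporal graph whose underlying graph is a split graph. $\mathcal{G}$ is monotonically shrinking if $E_{t+1}\subseteq E_t$ for all $t\ge 1$. A temporal walk from $u$ to $v$ is a sequence $(\{v_0=u,v_1\},t_1),(\{v_1,v_2\},t_2),\dots,(\{v_{d-1},v_d=v\},t_d)$ with $t_i<t_{i+1}$ for all $i\in\{1,\dots,d-1\}$ (strictly increasing times) and $\{v_{i-1},v_i\}\in E_{t_i}$ for all $i\in\{1,\dots,d\}$; its arrival time is $t_d$. The temporal distance $\mathrm{td}(u,v)$ is the minimum arrival time of a temporal walk from $u$ to $v$, with $\mathrm{td}(u,u)=0$ and $\mathrm{td}(u,v)=\infty$ if there is no such walk. In the two-player temporal Voronoi game $\mathrm{Vor}(\mathcal{G},2)$, each player $i\in\{1,2\}$ selects one vertex $p_i\in V$ (equal choices are allowed). Player $i$ wins the set $U_i(p_1,p_2)=\{v\in V\mid \mathrm{td}(p_i,v)<\mathrm{td}(p_j,v)\}$,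 where $j\ne i$ is the other player, and her payoff is $u_i(p_1,p_2)=|U_i(p_1,p_2)|$. A profile $(p_1,p_2)\in V^2$ is a Nash equilibrium if $u_1(p',p_2)\le u_1(p_1,p_2)$ and $u_2(p_1,p')\le u_2(p_1,p_2)$ for all $p'\in V$. *)

theory Defs
  imports "HOL-Library.Extended_Nat" "HOL-Library.Ramsey"
begin

text \<open>
  A temporal graph is given by its vertex set \<open>V\<close> and the family \<open>E\<close> of edge sets. Time steps
  are the positive integers; the value \<open>E 0\<close> is never used. The set \<open>[V]\<^bsup>2\<^esup>\<close> is the set of
  two-element subsets of \<open>V\<close>.
\<close>

definition temporal_graph :: "'a set \<Rightarrow> (nat \<Rightarrow> 'a set set) \<Rightarrow> bool" where
  "temporal_graph V E \<longleftrightarrow>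
     finite V \<and> V \<noteq> {} \<and> (\<forall>t\<ge>1. E t \<subseteq> [V]\<^bsup>2\<^esup>) \<and> (\<exists>\<tau>\<ge>1. \<forall>t\<ge>\<tau>. E t = E \<tau>)"

definition underlying_edges :: "(nat \<Rightarrow> 'a set set) \<Rightarrow> 'a set set" where
  "underlying_edges E = (\<Union>t\<in>{1..}. E t)"

text \<open>Either part of the partition may be empty.\<close>

definition split_graph :: "'a set \<Rightarrow> 'a set set \<Rightarrow> bool" where
  "split_graph V F \<longleftrightarrow>
     F \<subseteq> [V]\<^bsup>2\<^esup> \<and> (\<exists>C I. C \<union> I = V \<and> C \<inter> I = {} \<and> clique C F \<and> indep I F)"

definition temporal_split_graph :: "'a set \<Rightarrow> (nat \<Rightarrow> 'a set set) \<Rightarrow> bool" where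
  "temporal_split_graph V E \<longleftrightarrow> temporal_graph V E \<and> split_graph V (underlying_edges E)"

definition monotonically_shrinking :: "(nat \<Rightarrow> 'a set set) \<Rightarrow> bool" where
  "monotonically_shrinking E \<longleftrightarrow> (\<forall>t\<ge>1. E (Suc t) \<subseteq> E t)"

text \<open>
  A walk is the list of its (edge, time) pairs; \<open>p 0, \<dots>, p (length w)\<close> are the visited vertices,
  and the values of \<open>p\<close> beyond \<open>length w\<close> are irrelevant.
\<close>

definition temporal_walk ::
    "(nat \<Rightarrow> 'a set set) \<Rightarrow> 'a \<Rightarrow> 'a \<Rightarrow> ('a set \<times> nat) list \<Rightarrow> bool" where
  "temporal_walk E u v w \<longleftrightarrow>
     w \<noteq> [] \<and>
     (\<exists>p. p 0 = u \<and> p (length w) = v \<and> (\<forall>i<length w. fst (w ! i) = {p i, p (Suc i)})) \<and>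
     (\<forall>(e, t)\<in>set w. 1 \<le> t \<and> e \<in> E t) \<and>
     sorted_wrt (<) (map snd w)"

definition arrival_time :: "('a set \<times> nat) list \<Rightarrow> nat" where
  "arrival_time w = snd (last w)"

text \<open>The infimum of a nonempty set of \<open>enat\<close> values is attained; that of the empty set is \<open>\<infinity>\<close>.\<close>

definition temporal_dist :: "(nat \<Rightarrow> 'a set set) \<Rightarrow> 'a \<Rightarrow> 'a \<Rightarrow> enat" where
  "temporal_dist E u v =
     (if u = v then 0 else (INF w\<in>{w. temporal_walk E u v w}. enat (arrival_time w)))"

text \<open>
  The set and the payoff won by a player choosing \<open>p\<close> against an opponent choosing \<open>q\<close>. The
  payoffs of players 1 and 2 in the profile \<open>(p\<^sub>1, p\<^sub>2)\<close> are therefore \<open>voronoi_payoff V E p\<^sub>1 p\<^sub>2\<close>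
  and \<open>voronoi_payoff V E p\<^sub>2 p\<^sub>1\<close>.
\<close>

definition voronoi_set :: "'a set \<Rightarrow> (nat \<Rightarrow> 'a set set) \<Rightarrow> 'a \<Rightarrow> 'a \<Rightarrow> 'a set" where
  "voronoi_set V E p q = {v \<in> V. temporal_dist E p v < temporal_dist E q v}"

definition voronoi_payoff :: "'a set \<Rightarrow> (nat \<Rightarrow> 'a set set) \<Rightarrow> 'a \<Rightarrow> 'a \<Rightarrow> nat" where
  "voronoi_payoff V E p q = card (voronoi_set V E p q)"

definition nash_equilibrium :: "'a set \<Rightarrow> (nat \<Rightarrow> 'a set set) \<Rightarrow> 'a \<times> 'a \<Rightarrow> bool" where
  "nash_equilibrium V E = (\<lambda>(p\<^sub>1, p\<^sub>2).
     p\<^sub>1 \<in> V \<and> p\<^sub>2 \<in> V \<and>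
     (\<forall>p'\<in>V. voronoi_payoff V E p' p\<^sub>2 \<le> voronoi_payoff V E p\<^sub>1 p\<^sub>2) \<and>
     (\<forall>p'\<in>V. voronoi_payoff V E p' p\<^sub>1 \<le> voronoi_payoff V E p\<^sub>2 p\<^sub>1))"

end

theory Submission
  imports Defs
begin

text \<open>
  Since the graph shrinks, a vertex of the clique \<open>C\<close> reaches all of \<open>C\<close> by time 1, its neighbours
  in the independent set at time 1, and every other vertex at time 2 or not at all. Hence, against an
  opponent \<open>q \<in> C\<close>, a player wins only vertices in her closed neighbourhood: a choice outside \<open>C\<close>
  wins a single vertex, and a choice \<open>p \<in> C\<close> wins exactly \<open>S p - S q\<close>, where \<open>S p\<close> consists of \<open>p\<close>
  and its neighbours outside \<open>C\<close>. On \<open>C \<times> C\<close> the game therefore has the potential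
  \<open>card (S p \<union> S q)\<close>, and if \<open>C\<close> has at least two elements, a maximiser of it is an equilibrium of
  the whole game. Such a \<open>C\<close> exists as soon as there is an edge at all.
\<close>

section \<open>Temporal distances and short walks\<close>

lemma temporal_dist_le_1:
  assumes "{u, v} \<in> E 1"
  shows "temporal_dist E u v \<le> 1"
proof -
  have "temporal_walk E u v [({u, v}, 1)]"
    unfolding temporal_walk_def using assms
    by (auto intro!: exI[of _ "\<lambda>i. if i = 0 then u else v"])
  then have "(INF w\<in>{w. temporal_walk E u v w}. enat (arrival_time w))
      \<le> enat (arrival_time [({u, v}, 1)])"
    by (intro INF_lower) simp
  then show ?thesis
    by (simp add: temporal_dist_def arrival_time_def one_enat_def)
qed

lemma temporal_dist_le_2:
  assumes "{u, x} \<in> E 1" "{x, v} \<in> E 2"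
  shows "temporal_dist E u v \<le> 2"
proof -
  let ?w = "[({u, x}, 1), ({x, v}, 2)]"
  have "temporal_walk E u v ?w"
    unfolding temporal_walk_def using assms
    by (auto intro!: exI[of _ "\<lambda>i. if i = 0 then u else if i = 1 then x else v"]
        simp: less_Suc_eq)
  then have "(INF w\<in>{w. temporal_walk E u v w}. enat (arrival_time w)) \<le> enat (arrival_time ?w)"
    by (intro INF_lower) simp
  then show ?thesis
    by (simp add: temporal_dist_def arrival_time_def numeral_eq_enat)
qed

text \<open>The edge obtained is the last one of a walk arriving before \<open>k\<close>. Times are
  positive and strictly increase, so a walk arriving at time 1 has a single edge, which starts at
  \<open>u\<close>.\<close>

lemma temporal_dist_less_last_edge:
  assumes "temporal_dist E u v < k" "u \<noteq> v"
  obtains t x where "1 \<le> t" "enat t < k" "{x, v} \<in> E t" "t = 1 \<Longrightarrow> x = u"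
proof -
  from assms obtain w where w: "temporal_walk E u v w" and less: "enat (arrival_time w) < k"
    by (auto simp: temporal_dist_def INF_less_iff)
  from w obtain p where "w \<noteq> []" and p: "p 0 = u" "p (length w) = v"
    and edges: "\<And>i. i < length w \<Longrightarrow> fst (w ! i) = {p i, p (Suc i)}"
    and times: "\<And>e t. (e, t) \<in> set w \<Longrightarrow> 1 \<le> t \<and> e \<in> E t"
    and sorted: "sorted_wrt (<) (map snd w)"
    unfolding temporal_walk_def by blast
  define n where "n = length w - 1"
  have n: "n < length w" "length w = Suc n" and last: "last w = w ! n"
    using \<open>w \<noteq> []\<close> by (auto simp: n_def last_conv_nth)
  have at: "1 \<le> snd (w ! i) \<and> fst (w ! i) \<in> E (snd (w ! i))" if "i < length w" for i
    using times[of "fst (w ! i)" "snd (w ! i)"] nth_mem[OF that] by simp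
  have "n = 0" if "arrival_time w = 1"
  proof (rule ccontr)
    assume "n \<noteq> 0"
    then have "snd (w ! 0) < snd (w ! n)"
      using sorted_wrt_nth_less[OF sorted, of 0 n] n by simp
    moreover have "1 \<le> snd (w ! 0)"
      using at[of 0] n by simp
    ultimately show False
      using that last by (simp add: arrival_time_def)
  qed
  then have "arrival_time w = 1 \<Longrightarrow> p n = u"
    using p by simp
  moreover have "{p n, v} \<in> E (arrival_time w)" "1 \<le> arrival_time w"
    using at[OF n(1)] edges[OF n(1)] p n last by (auto simp: arrival_time_def)
  ultimately show thesis
    using that[of "arrival_time w" "p n"] less by blast
qed

lemma temporal_dist_less_2_adjacent:
  assumes "temporal_dist E u v < 2" "u \<noteq> v"
  shows "{u, v} \<in> E 1"
proof -
  obtain t x where "1 \<le> t" "enat t < 2" "{x, v} \<in> E t" "t = 1 \<Longrightarrow> x = u"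
    using temporal_dist_less_last_edge[OF assms] by blast
  moreover from this have "t = 1"
    by (simp add: numeral_eq_enat)
  ultimately show ?thesis
    by simp
qed

lemma temporal_dist_self [simp]: "temporal_dist E v v = 0"
  by (simp add: temporal_dist_def)

lemma temporal_dist_pos: "u \<noteq> v \<Longrightarrow> 0 < temporal_dist E u v"
  by (rule ccontr, rule temporal_dist_less_last_edge[of E u v 1])
    (simp, assumption, simp add: one_enat_def)

section \<open>Shrinking edge sets\<close>

lemma monotonically_shrinkingD:
  assumes "monotonically_shrinking E" "1 \<le> s" "s \<le> t"
  shows "E t \<subseteq> E s"
  using assms(3)
proof (induction t rule: dec_induct)
  case (step n)
  then show ?case
    using assms(1,2) unfolding monotonically_shrinking_def by (meson order_trans)
qed simp

lemma monotonically_shrinking_underlying_edges: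
  "monotonically_shrinking E \<Longrightarrow> underlying_edges E = E 1"
  unfolding underlying_edges_def using monotonically_shrinkingD[of E 1]
  by (intro equalityI UN_least UN_upper) auto

section \<open>The game relative to a fixed clique and independent set\<close>

locale shrinking_split =
  fixes V :: "'a set" and E :: "nat \<Rightarrow> 'a set set" and C I :: "'a set"
  assumes fin: "finite V"
    and shrink: "monotonically_shrinking E"
    and edges: "E 1 \<subseteq> [V]\<^bsup>2\<^esup>"
    and part: "C \<union> I = V" "C \<inter> I = {}"
    and clique: "clique C (E 1)"
    and indep: "indep I (E 1)"
begin

text \<open>Neighbours of \<open>p\<close> inside \<open>C\<close> are left out: any opponent in
  \<open>C\<close> reaches them by time 1 as well, so \<open>p\<close> does not win them.\<close>

definition S :: "'a \<Rightarrow> 'a set" where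
  "S p = insert p {v \<in> I. {p, v} \<in> E 1}"

lemma finite_S: "finite (S p)"
  using fin part finite_subset[of I V] by (auto simp: S_def)

lemma clique_dist_le_1:
  assumes "c \<in> C" "v \<in> C"
  shows "temporal_dist E c v \<le> 1"
  using assms clique temporal_dist_le_1[of c v E] by (cases "c = v") (auto simp: clique_def)

lemma neighbour_in_clique:
  assumes "{x, v} \<in> E 1" "v \<in> I"
  shows "x \<in> C"
proof -
  have "x \<in> V" "x \<noteq> v"
    using assms(1) edges by (auto simp: nsets_def)
  then show ?thesis
    using assms indep part unfolding indep_def by (metis UnE)
qed

text \<open>The last edge of a winning walk must be used at time 1: an edge from \<open>x\<close> to
  \<open>v\<close> that is still present later also exists at time 2, and \<open>c\<close> can then
  reach \<open>v\<close> through \<open>x\<close> by time 2.\<close>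

lemma win_against_clique:
  assumes "c \<in> C" "v \<in> V" "temporal_dist E p v < temporal_dist E c v" "v \<noteq> p"
  shows "v \<in> I \<and> {p, v} \<in> E 1"
proof -
  obtain t x where t: "1 \<le> t" "enat t < temporal_dist E c v" "{x, v} \<in> E t" "t = 1 \<Longrightarrow> x = p"
    using temporal_dist_less_last_edge[OF assms(3)] assms(4) by metis
  \<comment> \<open>The opponent reaches all of \<open>C\<close> by time 1, and \<open>p\<close>
    cannot reach another vertex before time 1.\<close>
  have "v \<notin> C"
    using clique_dist_le_1[OF assms(1)] t(1,2)
    by (metis enat_ord_simps(1) leD one_enat_def order_trans)
  then have v: "v \<in> I"
    using assms(2) part by blast
  have "t = 1"
  proof (rule ccontr)
    assume "t \<noteq> 1"
    then have "2 \<le> t"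
      using t(1) by simp
    then have xv: "{x, v} \<in> E 2" "{x, v} \<in> E 1"
      using t(3) monotonically_shrinkingD[OF shrink] t(1)
      by (meson one_le_numeral subsetD order_refl)+
    have "x \<in> C"
      using neighbour_in_clique[OF xv(2) v] .
    \<comment> \<open>If \<open>c = x\<close>, there is no clique edge to traverse and the edge to
      \<open>v\<close> is taken at time 1; otherwise \<open>c\<close> moves to \<open>x\<close> at
      time 1 and on to \<open>v\<close> at time 2.\<close>
    then have "temporal_dist E c v \<le> 2"
      using assms(1) clique xv temporal_dist_le_2[of c x E v] temporal_dist_le_1[of c v E]
      unfolding clique_def by (metis one_le_numeral order_trans)
    with t(2) have "enat t < 2"
      by (rule less_le_trans)
    with \<open>2 \<le> t\<close> show False
      by (simp add: numeral_eq_enat)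
  qed
  with t v show ?thesis
    by simp
qed

lemma voronoi_set_clique:
  assumes "p \<in> C" "q \<in> C"
  shows "voronoi_set V E p q = S p - S q"
proof (intro set_eqI iffI)
  fix v
  assume "v \<in> voronoi_set V E p q"
  then have v: "v \<in> V" "temporal_dist E p v < temporal_dist E q v"
    by (auto simp: voronoi_set_def)
  then have "v \<in> S p"
    using win_against_clique[OF assms(2) v] by (auto simp: S_def)
  moreover have "v \<notin> S q"
  proof
    assume "v \<in> S q"
    then have "v = q \<or> v \<in> I \<and> temporal_dist E q v \<le> 1"
      using temporal_dist_le_1[of q v E] by (auto simp: S_def)
    \<comment> \<open>Distance 0 cannot be beaten, which excludes \<open>v = q\<close>; distance at
      most 1 is beaten only by 0, which would force \<open>v = p\<close>, a vertex of
      \<open>C\<close>.\<close>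
    then have "temporal_dist E p v = 0" "v \<in> I"
      using v(2) by (auto simp: temporal_dist_def one_eSuc iless_eSuc0 dest: less_le_trans)
    then show False
      using temporal_dist_pos[of p v E] assms(1) part by auto
  qed
  ultimately show "v \<in> S p - S q"
    by blast
next
  fix v
  assume v: "v \<in> S p - S q"
  then have "v \<in> V" "v \<noteq> q"
    using assms part by (auto simp: S_def)
  show "v \<in> voronoi_set V E p q"
  proof (cases "v = p")
    case True
    then show ?thesis
      using \<open>v \<in> V\<close> \<open>v \<noteq> q\<close> temporal_dist_pos[of q v E]
      by (auto simp: voronoi_set_def)
  next
    case False
    then have "{p, v} \<in> E 1" "{q, v} \<notin> E 1"
      using v by (auto simp: S_def)
    then have "temporal_dist E p v \<le> 1" "2 \<le> temporal_dist E q v"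
      using temporal_dist_le_1 temporal_dist_less_2_adjacent[of E q v] \<open>v \<noteq> q\<close> by force+
    moreover have "(1 :: enat) < 2"
      by simp
    ultimately have "temporal_dist E p v < temporal_dist E q v"
      by (meson order.strict_trans1 order.strict_trans2)
    then show ?thesis
      using \<open>v \<in> V\<close> by (simp add: voronoi_set_def)
  qed
qed

text \<open>Winning a vertex other than \<open>p\<close> requires a neighbour of \<open>p\<close> in
  \<open>I\<close>, but all neighbours of such a vertex lie in \<open>C\<close>.\<close>

lemma payoff_outside_clique:
  assumes "p \<in> V" "p \<notin> C" "q \<in> C"
  shows "voronoi_payoff V E p q \<le> 1"
proof -
  have "voronoi_set V E p q \<subseteq> {p}"
    using win_against_clique[OF assms(3), of _ p] neighbour_in_clique[of p] assms(2)
    unfolding voronoi_set_def by blast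
  then show ?thesis
    unfolding voronoi_payoff_def using card_mono[of "{p}"] by force
qed

lemma nash_equilibrium_exists:
  assumes "a \<in> C" "b \<in> C" "a \<noteq> b"
  shows "\<exists>p\<^sub>1 p\<^sub>2. nash_equilibrium V E (p\<^sub>1, p\<^sub>2)"
proof -
  let ?\<Phi> = "\<lambda>(p, q). card (S p \<union> S q)"
  let ?M = "Max (?\<Phi> ` (C \<times> C))"
  have CC: "finite (?\<Phi> ` (C \<times> C))" "?\<Phi> ` (C \<times> C) \<noteq> {}"
    using fin part finite_subset[of C V] assms by auto
  then obtain p q where pq: "p \<in> C" "q \<in> C" "card (S p \<union> S q) = ?M"
    using Max_in[OF CC] by (elim imageE) (metis (mono_tags, lifting) SigmaE case_prod_conv)
  have max: "card (S p' \<union> S q') \<le> card (S p \<union> S q)" if "p' \<in> C" "q' \<in> C" for p' q'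
    unfolding pq(3) using CC(1) that by (intro Max_ge) auto
  \<comment> \<open>\<open>p\<close> and \<open>q\<close> are bound afresh, so that the claim serves
    both players.\<close>
  have best: "voronoi_payoff V E p' q \<le> voronoi_payoff V E p q"
    if pq: "p \<in> C" "q \<in> C" and max: "\<And>p'. p' \<in> C \<Longrightarrow> card (S p' \<union> S q) \<le> card (S p \<union> S q)"
      and "p' \<in> V" for p q p'
  proof -
    have inside: "voronoi_payoff V E r q \<le> voronoi_payoff V E p q" if "r \<in> C" for r
    proof -
      \<comment> \<open>For a fixed opponent \<open>q\<close>, payoff and potential differ by the
        constant \<open>card (S q)\<close>.\<close>
      have "card (S r \<union> S q) = card (S r - S q) + card (S q)" for r
        using card_Un_disjoint[of "S r - S q" "S q"] finite_S by auto
      then show ?thesis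
        using max[OF that] that pq by (simp add: voronoi_payoff_def voronoi_set_clique)
    qed
    show ?thesis
    proof (cases "p' \<in> C")
      case False
      \<comment> \<open>A second clique vertex wins at least itself, hence at least as much as any
        choice outside \<open>C\<close>.\<close>
      obtain r where r: "r \<in> C" "r \<noteq> q"
        using assms by metis
      then have "r \<in> S r - S q"
        using part by (auto simp: S_def)
      then have "1 \<le> voronoi_payoff V E r q"
        using r pq finite_S
        by (auto simp: voronoi_payoff_def voronoi_set_clique Suc_le_eq card_gt_0_iff)
      then show ?thesis
        using payoff_outside_clique[OF \<open>p' \<in> V\<close> False pq(2)] inside[OF r(1)] by linarith
    qed (rule inside)
  qed
  have "card (S p' \<union> S p) \<le> card (S q \<union> S p)" if "p' \<in> C" for p'
    using max[OF pq(1) that] by (simp only: Un_commute)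
  then have "nash_equilibrium V E (p, q)"
    unfolding nash_equilibrium_def prod.case
    using best[OF pq(1,2) max[OF _ pq(2)]] best[OF pq(2,1)] pq part by blast
  then show ?thesis
    by blast
qed

end

section \<open>Edgeless graphs, and the reduction to a clique of two vertices\<close>

lemma nash_equilibrium_exists_edgeless:
  assumes "finite V" "V \<noteq> {}" "monotonically_shrinking E" "E 1 = {}"
  shows "\<exists>p\<^sub>1 p\<^sub>2. nash_equilibrium V E (p\<^sub>1, p\<^sub>2)"
proof -
  have "E t = {}" if "1 \<le> t" for t
    using monotonically_shrinkingD[OF assms(3) _ that] assms(4) by simp
  \<comment> \<open>With bound \<open>\<infinity>\<close>, a finite distance would yield an
    edge.\<close>
  then have "\<not> temporal_dist E u v < \<infinity>" if "u \<noteq> v" for u v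
    using temporal_dist_less_last_edge[OF _ that, of E \<infinity>] by blast
  then have "temporal_dist E u v = (if u = v then 0 else \<infinity>)" for u v
    by simp
  then have "voronoi_set V E p q = (if p = q then {} else {p})" if "p \<in> V" for p q
    using that by (auto simp: voronoi_set_def enat_0_iff)
  then have payoff: "voronoi_payoff V E p q = (if p = q then 0 else 1)" if "p \<in> V" for p q
    using that by (simp add: voronoi_payoff_def)
  obtain p where p: "p \<in> V"
    using assms(2) by blast
  show ?thesis
  proof (cases "V = {p}")
    case True
    then have "nash_equilibrium V E (p, p)"
      by (simp add: nash_equilibrium_def)
    then show ?thesis
      by blast
  next
    case False
    then obtain q where "q \<in> V" "q \<noteq> p"
      using p by blast
    with p have "nash_equilibrium V E (p, q)"
      by (simp add: nash_equilibrium_def payoff)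
    then show ?thesis
      by blast
  qed
qed

theorem theorem13:
  fixes V :: "'a set" and E :: "nat \<Rightarrow> 'a set set"
  assumes "temporal_split_graph V E"
    and "monotonically_shrinking E"
  shows "\<exists>p\<^sub>1 p\<^sub>2. nash_equilibrium V E (p\<^sub>1, p\<^sub>2)"
proof (cases "E 1 = {}")
  case True
  then show ?thesis
    using assms nash_equilibrium_exists_edgeless
    by (auto simp: temporal_split_graph_def temporal_graph_def)
next
  case False
  have "underlying_edges E = E 1"
    using assms(2) by (rule monotonically_shrinking_underlying_edges)
  then obtain C I where V: "finite V" "E 1 \<subseteq> [V]\<^bsup>2\<^esup>" and CI: "C \<union> I = V" "C \<inter> I = {}"
    "clique C (E 1)" "indep I (E 1)"
    using assms(1) by (auto simp: temporal_split_graph_def temporal_graph_def split_graph_def)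
  interpret shrinking_split V E C I
    using V CI assms(2) by unfold_locales
  \<comment> \<open>As \<open>I\<close> is independent, every edge has an endpoint in
    \<open>C\<close>; it is named \<open>a\<close>.\<close>
  obtain a b where ab: "{a, b} \<in> E 1" "a \<in> C" "b \<in> V" "a \<noteq> b"
  proof -
    from False V obtain x y where xy: "{x, y} \<in> E 1" "x \<in> V" "y \<in> V" "x \<noteq> y"
      by (fastforce simp: nsets_def card_2_iff)
    show thesis
    proof (cases "y \<in> I")
      case True
      then show thesis
        using that[of x y] neighbour_in_clique[of x y] xy by blast
    next
      case False
      then show thesis
        using that[of y x] xy part by (auto simp: insert_commute)
    qed
  qed
  show ?thesis
  proof (cases "\<exists>c\<in>C. c \<noteq> a")
    case True
    then show ?thesis
      using nash_equilibrium_exists ab(2) by metis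
  next
    case False
    then have "C = {a}"
      using ab(2) by blast
    \<comment> \<open>Moving one neighbour of \<open>a\<close> into the clique leaves a valid partition.\<close>
    interpret moved: shrinking_split V E "{a, b}" "I - {b}"
      using V CI assms(2) ab \<open>C = {a}\<close>
      by unfold_locales (auto simp: clique_def indep_def insert_commute)
    show ?thesis
      using moved.nash_equilibrium_exists ab(4) by blast
  qed
qed

end
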